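(* Let $\mathcal{E}$ be a right Hilbert $C^*$-module over a unital $C^*$-algebra $\mathcal{A}$, let $\mathcal{H}$ be a Hilbert space, let $\varphi:\mathcal{A}\to\mathcal{B}(\mathcal{H})$ be a completely positive map, and let $(\pi,\mathcal{K},V)$ be the minimal Stinespring dilation triple of $\varphi$. Let $\mathcal{H}_{\varphi},\mathcal{K}_{\pi}$ be Hilbert spaces, $W_{\varphi}:\mathcal{H}_{\varphi}\to\mathcal{K}_{\pi}$ a unitary operator, $\Phi_{\varphi}:\mathcal{E}\to\mathcal{B}(\mathcal{H},\mathcal{H}_{\varphi})$ a non-degenerate $\varphi$-map and $\Psi_{\pi}:\mathcal{E}\to\mathcal{B}(\mathcal{K},\mathcal{K}_{\pi})$ a non-degenerate $\pi$-representation such that $\Phi_{\varphi}(x)=W_{\varphi}^*\Psi_{\pi}(x)V$ for all $x\in\mathcal{E}$. Let $\mathcal{H}'$ and $\mathcal{K}'$ be Hilbert spaces. Then: (i) A map $\Phi:\mathcal{E}\to\mathcal{B}(\mathcal{H},\mathcal{H}')$ is a $\varphi$-map if and only if there exist an isometry $S_{\Phi}:\mathcal{H}_{\varphi}\to\mathcal{H}'$ and a coisometry $W:\mathcal{H}'\to\mathcal{K}_{\pi}$ such that $S_{\Phi}\Phi_{\varphi}(x)=\Phi(x)$ and $\Phi(x)=W^*\Psi_{\pi}(x)V$ for all $x\in\mathcal{E}$. Moreover, $\Phi$ is a non-degenerate $\varphi$-map if and only if there exist unitary operators $S_{\Phi}:\mathcal{H}_{\varphi}\to\mathcal{H}'$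 and $W:\mathcal{H}'\to\mathcal{K}_{\pi}$ satisfying these two identities. (ii) A map $\Phi:\mathcal{E}\to\mathcal{B}(\mathcal{H},\mathcal{H}')$ is a completely semi-$\varphi$-map if and only if there exist a contraction $S:\mathcal{H}_{\varphi}\to\mathcal{H}'$ and a contraction $W:\mathcal{H}'\to\mathcal{K}_{\pi}$ such that $S\Phi_{\varphi}(x)=\Phi(x)$ and $\Phi(x)=W^*\Psi_{\pi}(x)V$ for all $x\in\mathcal{E}$. Moreover, $\Phi$ is a non-degenerate completely semi-$\varphi$-map if and only if there exist a contraction $S:\mathcal{H}_{\varphi}\to\mathcal{H}'$ with dense range and an injective contraction $W:\mathcal{H}'\to\mathcal{K}_{\pi}$ satisfying these two identities. (iii) A map $\Psi:\mathcal{E}\to\mathcal{B}(\mathcal{K},\mathcal{K}')$ is a $\pi$-representation if and only if there exists an isometry $S_{\Psi}:\mathcal{K}_{\pi}\to\mathcal{K}'$ such that $\Psi(x)=S_{\Psi}\Psi_{\pi}(x)$ for all $x\in\mathcal{E}$. Moreover, $\Psi$ is a non-degenerate $\pi$-representation if and only if there exists a unitary $S_{\Psi}:\mathcal{K}_{\pi}\to\mathcal{K}'$ satisfying this identity. (iv) If $\Psi:\mathcal{E}\to\mathcal{B}(\mathcal{K},\mathcal{K}')$ is a $\pi$-representation and $\Phi:\mathcal{E}\to\mathcal{B}(\mathcal{H},\mathcal{H}')$ is a $\varphi$-map, then there exists a partial isometry $W:\mathcal{H}'\to\mathcal{K}'$ such that $\Phi(x)=W^*\Psi(x)V$ for all $x\in\mathcal{E}$.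 Moreover, $W$ is unitary when $\Phi$ and $\Psi$ are non-degenerate.
   Context: $\mathcal{B}(\mathcal{H},\mathcal{K})$ denotes the bounded operators from $\mathcal{H}$ to $\mathcal{K}$, and $\mathcal{B}(\mathcal{H})=\mathcal{B}(\mathcal{H},\mathcal{H})$; $[\,\cdot\,]$ denotes closed linear span. The $\mathcal{A}$-valued inner product $\langle\cdot,\cdot\rangle$ of $\mathcal{E}$ is conjugate-linear in the first variable and linear in the second. A coisometry is a bounded operator whose adjoint is an isometry. Minimal Stinespring dilation triple of $\varphi$: $\mathcal{K}$ is a Hilbert space, $\pi:\mathcal{A}\to\mathcal{B}(\mathcal{K})$ is a $*$-representation, $V\in\mathcal{B}(\mathcal{H},\mathcal{K})$, $\varphi(a)=V^*\pi(a)V$ for all $a\in\mathcal{A}$, and $[\pi(\mathcal{A})V\mathcal{H}]=\mathcal{K}$ (such a triple is unique up to unitary equivalence). For a completely positive map $\theta:\mathcal{A}\to\mathcal{B}(\mathcal{H}_1)$, a map $\Phi:\mathcal{E}\to\mathcal{B}(\mathcal{H}_1,\mathcal{H}_2)$ (not assumed linear) is a $\theta$-map if $\Phi(x)^*\Phi(y)=\theta(\langle x,y\rangle)$ for all $x,y\in\mathcal{E}$. When $\theta$ is a $*$-representation, a $\theta$-map is called a $\theta$-representation. The map $\Phi$ is non-degenerate if $[\Phi(\mathcal{E})\mathcal{H}_1]=\mathcal{H}_2$. The map $\Phi$ is a completely semi-$\theta$-map if $\Phi_n(x)^*\Phi_n(x)\le\theta_n(\langle x,x\rangle)$ for every $n\in\mathbb{N}$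 and $x\in\mathbb{M}_n(\mathcal{E})$, where $\Phi_n,\theta_n$ are the entrywise applications of $\Phi,\theta$ to $n\times n$ matrices, and $\mathbb{M}_n(\mathcal{E})$ carries the $\mathbb{M}_n(\mathcal{A})$-valued inner product $\langle [x_{ij}],[y_{ij}]\rangle=\big[\sum_k\langle x_{ki},y_{kj}\rangle\big]_{i,j}$. *)

theory Defs
  imports "HOL-Analysis.Analysis" "HOL-Library.Complex_Order"
begin

section \<open>Complex normed spaces and Hilbert spaces\<close>

text \<open>The libraries imported here provide only real vector, normed and inner product spaces;
  the classes below add a complex scalar multiplication that extends \<open>scaleR\<close>.\<close>

class complex_vector = real_vector +
  fixes scaleC :: "complex \<Rightarrow> 'a \<Rightarrow> 'a" (infixr "*\<^sub>C" 75)
  assumes scaleC_add_right: "a *\<^sub>C (x + y) = a *\<^sub>C x + a *\<^sub>C y"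
    and scaleC_add_left: "(a + b) *\<^sub>C x = a *\<^sub>C x + b *\<^sub>C x"
    and scaleC_scaleC: "a *\<^sub>C (b *\<^sub>C x) = (a * b) *\<^sub>C x"
    and scaleC_one: "1 *\<^sub>C x = x"
    and scaleR_scaleC: "r *\<^sub>R x = complex_of_real r *\<^sub>C x"

abbreviation clinear :: "('a::complex_vector \<Rightarrow> 'b::complex_vector) \<Rightarrow> bool"
  where "clinear \<equiv> Vector_Spaces.linear scaleC scaleC"

class complex_normed_vector = complex_vector + real_normed_vector +
  assumes norm_scaleC: "norm (a *\<^sub>C x) = cmod a * norm x"

class cbanach = complex_normed_vector + complete_space

text \<open>The inner product is conjugate-linear in the first and linear in the second variable.\<close>

class complex_inner = complex_normed_vector +
  fixes cinner :: "'a \<Rightarrow> 'a \<Rightarrow> complex"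
  assumes cinner_commute: "cinner x y = cnj (cinner y x)"
    and cinner_add_right: "cinner x (y + z) = cinner x y + cinner x z"
    and cinner_scaleC_right: "cinner x (a *\<^sub>C y) = a * cinner x y"
    and cinner_ge_zero: "0 \<le> cinner x x"
    and cinner_eq_zero_iff: "cinner x x = 0 \<longleftrightarrow> x = 0"
    and norm_eq_sqrt_cinner: "norm x = sqrt (cmod (cinner x x))"

class chilbert_space = complex_inner + complete_space

definition closed_cspan :: "'a::complex_normed_vector set \<Rightarrow> 'a set"
  where "closed_cspan S = closure (module.span scaleC S)"

lemma vector_space_scaleC: "vector_space (scaleC :: complex \<Rightarrow> 'a::complex_vector \<Rightarrow> 'a)"
  by (simp add: vector_space_def scaleC_add_right scaleC_add_left scaleC_scaleC scaleC_one)

lemma clinear_iff: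
  "clinear f \<longleftrightarrow> (\<forall>x y. f (x + y) = f x + f y) \<and> (\<forall>a x. f (a *\<^sub>C x) = a *\<^sub>C f x)"
  by (simp add: Vector_Spaces.linear_iff vector_space_scaleC)

lemma scaleC_zero_right: "a *\<^sub>C (0::'a::complex_vector) = 0"
  by (metis add_cancel_right_right scaleC_add_right)

lemma scaleC_minus_right: "a *\<^sub>C (- x) = - (a *\<^sub>C (x::'a::complex_vector))"
  by (metis add.right_inverse add_eq_0_iff scaleC_add_right scaleC_zero_right)


section \<open>Bounded operators\<close>

typedef (overloaded) ('a, 'b) bounded_op  ("(_ \<Rightarrow>\<^sub>B /_)" [22, 21] 21) =
  "{f :: 'a::complex_normed_vector \<Rightarrow> 'b::complex_normed_vector.
     clinear f \<and> (\<exists>K. \<forall>x. norm (f x) \<le> norm x * K)}"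
  morphisms op_apply Bounded_Op
  by (rule exI[of _ "\<lambda>_. 0"]) (auto simp: clinear_iff scaleC_zero_right intro!: exI[of _ 0])

declare [[coercion op_apply]]

setup_lifting type_definition_bounded_op

instantiation bounded_op :: (complex_normed_vector, complex_normed_vector) complex_vector
begin

lift_definition zero_bounded_op :: "'a \<Rightarrow>\<^sub>B 'b" is "\<lambda>_. 0"
  by (auto simp: clinear_iff scaleC_zero_right intro!: exI[of _ 0])

lift_definition plus_bounded_op :: "'a \<Rightarrow>\<^sub>B 'b \<Rightarrow> 'a \<Rightarrow>\<^sub>B 'b \<Rightarrow> 'a \<Rightarrow>\<^sub>B 'b" is "\<lambda>S T x. S x + T x"
proof (safe, goal_cases)
  case (1 S T K L)
  then show ?case by (simp add: clinear_iff scaleC_add_right algebra_simps)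
next
  case (2 S T K L)
  have "norm (S x + T x) \<le> norm x * (K + L)" for x
    using norm_triangle_ineq[of "S x" "T x"] 2(2)[rule_format, of x] 2(4)[rule_format, of x]
    by (simp add: distrib_left)
  then show ?case by blast
qed

lift_definition uminus_bounded_op :: "'a \<Rightarrow>\<^sub>B 'b \<Rightarrow> 'a \<Rightarrow>\<^sub>B 'b" is "\<lambda>T x. - T x"
  by (auto simp: clinear_iff scaleC_minus_right)

definition minus_bounded_op :: "'a \<Rightarrow>\<^sub>B 'b \<Rightarrow> 'a \<Rightarrow>\<^sub>B 'b \<Rightarrow> 'a \<Rightarrow>\<^sub>B 'b"
  where "S - T = S + - (T :: 'a \<Rightarrow>\<^sub>B 'b)"

lift_definition scaleC_bounded_op :: "complex \<Rightarrow> 'a \<Rightarrow>\<^sub>B 'b \<Rightarrow> 'a \<Rightarrow>\<^sub>B 'b" is "\<lambda>a T x. a *\<^sub>C T x"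
proof (safe, goal_cases)
  case (1 a T K)
  then show ?case by (simp add: clinear_iff scaleC_add_right scaleC_scaleC mult.commute)
next
  case (2 a T K)
  have "norm (a *\<^sub>C T x) \<le> norm x * (cmod a * K)" for x
    using mult_left_mono[OF 2(2)[rule_format, of x] norm_ge_zero[of a]]
    by (simp add: norm_scaleC mult_ac)
  then show ?case by blast
qed

definition scaleR_bounded_op :: "real \<Rightarrow> 'a \<Rightarrow>\<^sub>B 'b \<Rightarrow> 'a \<Rightarrow>\<^sub>B 'b"
  where "r *\<^sub>R T = complex_of_real r *\<^sub>C (T :: 'a \<Rightarrow>\<^sub>B 'b)"

instance
proof
  fix r s :: real and a b :: complex and S T U :: "'a \<Rightarrow>\<^sub>B 'b"
  show "S + T + U = S + (T + U)" by transfer (simp add: add.assoc)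
  show "S + T = T + S" by transfer (simp add: add.commute)
  show "0 + S = S" by transfer simp
  show "- S + S = 0" by transfer simp
  show "S - T = S + - T" by (fact minus_bounded_op_def)
  show add_right: "a *\<^sub>C (S + T) = a *\<^sub>C S + a *\<^sub>C T" for a and S T :: "'a \<Rightarrow>\<^sub>B 'b"
    by transfer (simp add: scaleC_add_right)
  show add_left: "(a + b) *\<^sub>C S = a *\<^sub>C S + b *\<^sub>C S" for a b and S :: "'a \<Rightarrow>\<^sub>B 'b"
    by transfer (simp add: scaleC_add_left)
  show assoc: "a *\<^sub>C (b *\<^sub>C S) = (a * b) *\<^sub>C S" for a b and S :: "'a \<Rightarrow>\<^sub>B 'b"
    by transfer (simp add: scaleC_scaleC)
  show one: "1 *\<^sub>C S = S" for S :: "'a \<Rightarrow>\<^sub>B 'b"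
    by transfer (simp add: scaleC_one)
  show "r *\<^sub>R S = complex_of_real r *\<^sub>C S" by (fact scaleR_bounded_op_def)
  show "r *\<^sub>R (S + T) = r *\<^sub>R S + r *\<^sub>R T" by (simp add: scaleR_bounded_op_def add_right)
  show "(r + s) *\<^sub>R S = r *\<^sub>R S + s *\<^sub>R S" by (simp add: scaleR_bounded_op_def add_left)
  show "r *\<^sub>R s *\<^sub>R S = (r * s) *\<^sub>R S" by (simp add: scaleR_bounded_op_def assoc)
  show "1 *\<^sub>R S = S" by (simp add: scaleR_bounded_op_def one)
qed

end

lift_definition id_op :: "'a::complex_normed_vector \<Rightarrow>\<^sub>B 'a" is "\<lambda>x. x"
  by (auto simp: clinear_iff intro!: exI[of _ 1])

lift_definition comp_op ::
  "'b::complex_normed_vector \<Rightarrow>\<^sub>B 'c::complex_normed_vector \<Rightarrow> 'a::complex_normed_vector \<Rightarrow>\<^sub>B 'b \<Rightarrow> 'a \<Rightarrow>\<^sub>B 'c"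
  (infixl "o\<^sub>B" 70) is "\<lambda>S T x. S (T x)"
proof (safe, goal_cases)
  case (1 S T K L)
  then show ?case by (simp add: clinear_iff)
next
  case (2 S T K L)
  have "norm (S (T x)) \<le> norm x * (\<bar>L\<bar> * \<bar>K\<bar>)" for x
  proof -
    have "norm (S (T x)) \<le> norm (T x) * \<bar>K\<bar>"
      using 2(2)[rule_format, of "T x"] mult_left_mono[OF abs_ge_self[of K] norm_ge_zero[of "T x"]]
      by linarith
    also have "norm (T x) \<le> norm x * \<bar>L\<bar>"
      using 2(4)[rule_format, of x] mult_left_mono[OF abs_ge_self[of L] norm_ge_zero[of x]]
      by linarith
    finally show ?thesis by (simp add: mult_right_mono mult.assoc)
  qed
  then show ?case by blast
qed

text \<open>On Hilbert spaces the adjoint exists and is unique by the Riesz representation theorem.\<close>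

definition adj :: "'a::chilbert_space \<Rightarrow>\<^sub>B 'b::chilbert_space \<Rightarrow> 'b \<Rightarrow>\<^sub>B 'a"
  where "adj T = (THE S :: 'b \<Rightarrow>\<^sub>B 'a. \<forall>x y. cinner (S x) y = cinner x (T y))"

definition isometry_op :: "'a::chilbert_space \<Rightarrow>\<^sub>B 'b::chilbert_space \<Rightarrow> bool"
  where "isometry_op T \<longleftrightarrow> (\<forall>x. norm (T x) = norm x)"

definition coisometry_op :: "'a::chilbert_space \<Rightarrow>\<^sub>B 'b::chilbert_space \<Rightarrow> bool"
  where "coisometry_op T \<longleftrightarrow> isometry_op (adj T)"

definition unitary_op :: "'a::chilbert_space \<Rightarrow>\<^sub>B 'b::chilbert_space \<Rightarrow> bool"
  where "unitary_op T \<longleftrightarrow> adj T o\<^sub>B T = id_op \<and> T o\<^sub>B adj T = id_op"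

definition contraction_op :: "'a::chilbert_space \<Rightarrow>\<^sub>B 'b::chilbert_space \<Rightarrow> bool"
  where "contraction_op T \<longleftrightarrow> (\<forall>x. norm (T x) \<le> norm x)"

definition partial_isometry_op :: "'a::chilbert_space \<Rightarrow>\<^sub>B 'b::chilbert_space \<Rightarrow> bool"
  where "partial_isometry_op T \<longleftrightarrow>
    (\<forall>x. (\<forall>y. T y = 0 \<longrightarrow> cinner y x = 0) \<longrightarrow> norm (T x) = norm x)"

definition dense_range :: "'a::chilbert_space \<Rightarrow>\<^sub>B 'b::chilbert_space \<Rightarrow> bool"
  where "dense_range T \<longleftrightarrow> closure (range T) = UNIV"


section \<open>Unital C*-algebras and Hilbert C*-modules\<close>

class cstar_algebra = cbanach + real_normed_algebra +
  fixes star :: "'a \<Rightarrow> 'a"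
  assumes mult_scaleC_left: "(c *\<^sub>C a) * b = c *\<^sub>C (a * b)"
    and mult_scaleC_right: "a * (c *\<^sub>C b) = c *\<^sub>C (a * b)"
    and star_star: "star (star a) = a"
    and star_add: "star (a + b) = star a + star b"
    and star_scaleC: "star (c *\<^sub>C a) = cnj c *\<^sub>C star a"
    and star_mult: "star (a * b) = star b * star a"
    and norm_star_mult_self: "norm (star a * a) = (norm a)\<^sup>2"

text \<open>The library classes \<open>ring_1\<close> and \<open>real_normed_algebra_1\<close> require \<open>0 \<noteq> 1\<close>;
  \<open>monoid_mult\<close> only provides the unit, so that the zero algebra is not excluded.\<close>

class unital_cstar_algebra = cstar_algebra + monoid_mult

definition cstar_positive :: "'a::cstar_algebra \<Rightarrow> bool"
  where "cstar_positive a \<longleftrightarrow> (\<exists>b. a = star b * b)"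

text \<open>Completeness of the module is that of the class \<open>cbanach\<close>; \<open>norm_ip\<close> says that the norm of
  the class is the one induced by the \<open>'a\<close>-valued inner product \<open>ip\<close>.\<close>

locale hilbert_cstar_module =
  fixes act :: "'e::cbanach \<Rightarrow> 'a::unital_cstar_algebra \<Rightarrow> 'e"
    and ip :: "'e \<Rightarrow> 'e \<Rightarrow> 'a"
  assumes act_add_left: "act (x + y) a = act x a + act y a"
    and act_add_right: "act x (a + b) = act x a + act x b"
    and act_mult: "act x (a * b) = act (act x a) b"
    and act_one: "act x 1 = x"
    and act_scaleC_left: "act (c *\<^sub>C x) a = c *\<^sub>C act x a"
    and act_scaleC_right: "act x (c *\<^sub>C a) = c *\<^sub>C act x a"
    and ip_add_right: "ip x (y + z) = ip x y + ip x z"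
    and ip_scaleC_right: "ip x (c *\<^sub>C y) = c *\<^sub>C ip x y"
    and ip_act_right: "ip x (act y a) = ip x y * a"
    and ip_star: "star (ip x y) = ip y x"
    and ip_positive: "cstar_positive (ip x x)"
    and ip_definite: "ip x x = 0 \<Longrightarrow> x = 0"
    and norm_ip: "norm x = sqrt (norm (ip x x))"


section \<open>Matrices\<close>

text \<open>An \<open>n \<times> n\<close> matrix is a function \<open>nat \<Rightarrow> nat \<Rightarrow> _\<close> of which only the entries with indices
  below \<open>n\<close> are relevant; a vector of the \<open>n\<close>-fold direct sum of a Hilbert space is likewise a
  function on \<open>nat\<close>.\<close>

definition cstar_mat_positive :: "nat \<Rightarrow> (nat \<Rightarrow> nat \<Rightarrow> 'a::cstar_algebra) \<Rightarrow> bool"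
  where "cstar_mat_positive n a \<longleftrightarrow>
    (\<exists>b. \<forall>i<n. \<forall>j<n. a i j = (\<Sum>k<n. star (b k i) * b k j))"

definition op_mat_positive :: "nat \<Rightarrow> (nat \<Rightarrow> nat \<Rightarrow> 'h::chilbert_space \<Rightarrow>\<^sub>B 'h) \<Rightarrow> bool"
  where "op_mat_positive n T \<longleftrightarrow>
    (\<forall>h :: nat \<Rightarrow> 'h. 0 \<le> (\<Sum>i<n. \<Sum>j<n. cinner (h i) (T i j (h j))))"

definition op_mat_le ::
  "nat \<Rightarrow> (nat \<Rightarrow> nat \<Rightarrow> 'h::chilbert_space \<Rightarrow>\<^sub>B 'h) \<Rightarrow> (nat \<Rightarrow> nat \<Rightarrow> 'h \<Rightarrow>\<^sub>B 'h) \<Rightarrow> bool"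
  where "op_mat_le n S T \<longleftrightarrow> op_mat_positive n (\<lambda>i j. T i j - S i j)"

definition op_mat_adj ::
  "(nat \<Rightarrow> nat \<Rightarrow> 'h::chilbert_space \<Rightarrow>\<^sub>B 'k::chilbert_space) \<Rightarrow> nat \<Rightarrow> nat \<Rightarrow> 'k \<Rightarrow>\<^sub>B 'h"
  where "op_mat_adj T i j = adj (T j i)"

definition op_mat_mult ::
  "nat \<Rightarrow> (nat \<Rightarrow> nat \<Rightarrow> 'k::chilbert_space \<Rightarrow>\<^sub>B 'l::chilbert_space) \<Rightarrow>
   (nat \<Rightarrow> nat \<Rightarrow> 'h::chilbert_space \<Rightarrow>\<^sub>B 'k) \<Rightarrow> nat \<Rightarrow> nat \<Rightarrow> 'h \<Rightarrow>\<^sub>B 'l"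
  where "op_mat_mult n S T i j = (\<Sum>k<n. S i k o\<^sub>B T k j)"

definition mat_ip ::
  "('e \<Rightarrow> 'e \<Rightarrow> 'a::cstar_algebra) \<Rightarrow> nat \<Rightarrow> (nat \<Rightarrow> nat \<Rightarrow> 'e) \<Rightarrow> (nat \<Rightarrow> nat \<Rightarrow> 'e) \<Rightarrow> nat \<Rightarrow> nat \<Rightarrow> 'a"
  where "mat_ip ip n x y i j = (\<Sum>k<n. ip (x k i) (y k j))"

definition entrywise :: "('x \<Rightarrow> 'y) \<Rightarrow> (nat \<Rightarrow> nat \<Rightarrow> 'x) \<Rightarrow> nat \<Rightarrow> nat \<Rightarrow> 'y"
  where "entrywise f x i j = f (x i j)"


section \<open>Completely positive maps, dilations and maps on Hilbert C*-modules\<close>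

definition completely_positive :: "('a::cstar_algebra \<Rightarrow> 'h::chilbert_space \<Rightarrow>\<^sub>B 'h) \<Rightarrow> bool"
  where "completely_positive \<theta> \<longleftrightarrow>
    clinear \<theta> \<and> (\<forall>n a. cstar_mat_positive n a \<longrightarrow> op_mat_positive n (entrywise \<theta> a))"

definition star_representation :: "('a::cstar_algebra \<Rightarrow> 'h::chilbert_space \<Rightarrow>\<^sub>B 'h) \<Rightarrow> bool"
  where "star_representation \<pi> \<longleftrightarrow>
    clinear \<pi> \<and> (\<forall>a b. \<pi> (a * b) = \<pi> a o\<^sub>B \<pi> b) \<and> (\<forall>a. \<pi> (star a) = adj (\<pi> a))"

definition minimal_stinespring ::
  "('a::cstar_algebra \<Rightarrow> 'h::chilbert_space \<Rightarrow>\<^sub>B 'h) \<Rightarrow>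
   ('a \<Rightarrow> 'k::chilbert_space \<Rightarrow>\<^sub>B 'k) \<Rightarrow> ('h \<Rightarrow>\<^sub>B 'k) \<Rightarrow> bool"
  where "minimal_stinespring \<phi> \<pi> V \<longleftrightarrow>
    star_representation \<pi> \<and>
    (\<forall>a. \<phi> a = adj V o\<^sub>B \<pi> a o\<^sub>B V) \<and>
    closed_cspan {\<pi> a (V h) | a h. True} = UNIV"

definition theta_map ::
  "('e \<Rightarrow> 'e \<Rightarrow> 'a::cstar_algebra) \<Rightarrow> ('a \<Rightarrow> 'h::chilbert_space \<Rightarrow>\<^sub>B 'h) \<Rightarrow>
   ('e \<Rightarrow> 'h \<Rightarrow>\<^sub>B 'k::chilbert_space) \<Rightarrow> bool"
  where "theta_map ip \<theta> \<Phi> \<longleftrightarrow> (\<forall>x y. adj (\<Phi> x) o\<^sub>B \<Phi> y = \<theta> (ip x y))"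

definition theta_representation ::
  "('e \<Rightarrow> 'e \<Rightarrow> 'a::cstar_algebra) \<Rightarrow> ('a \<Rightarrow> 'h::chilbert_space \<Rightarrow>\<^sub>B 'h) \<Rightarrow>
   ('e \<Rightarrow> 'h \<Rightarrow>\<^sub>B 'k::chilbert_space) \<Rightarrow> bool"
  where "theta_representation ip \<theta> \<Psi> \<longleftrightarrow> star_representation \<theta> \<and> theta_map ip \<theta> \<Psi>"

definition nondegenerate :: "('e \<Rightarrow> 'h::chilbert_space \<Rightarrow>\<^sub>B 'k::chilbert_space) \<Rightarrow> bool"
  where "nondegenerate \<Phi> \<longleftrightarrow> closed_cspan {\<Phi> x h | x h. True} = UNIV"

definition completely_semi_map ::
  "('e \<Rightarrow> 'e \<Rightarrow> 'a::cstar_algebra) \<Rightarrow> ('a \<Rightarrow> 'h::chilbert_space \<Rightarrow>\<^sub>B 'h) \<Rightarrow>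
   ('e \<Rightarrow> 'h \<Rightarrow>\<^sub>B 'k::chilbert_space) \<Rightarrow> bool"
  where "completely_semi_map ip \<theta> \<Phi> \<longleftrightarrow>
    (\<forall>n x. op_mat_le n
       (op_mat_mult n (op_mat_adj (entrywise \<Phi> x)) (entrywise \<Phi> x))
       (entrywise \<theta> (mat_ip ip n x x)))"

end

theory Submission
  imports Defs
begin

text \<open>Both a \<open>\<phi>\<close>-map and a completely semi-\<open>\<phi>\<close>-map \<open>\<Phi>\<close> compare \<open>\<parallel>\<Sum>\<^sub>j \<Phi>(x\<^sub>j)h\<^sub>j\<parallel>\<close> with
  \<open>\<parallel>\<Sum>\<^sub>j \<Phi>\<^sub>\<phi>(x\<^sub>j)h\<^sub>j\<parallel>\<close>, by an equality and an inequality respectively. Since the vectors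
  \<open>\<Phi>\<^sub>\<phi>(x)h\<close> are total, \<open>\<Phi>\<^sub>\<phi>(x)h \<mapsto> \<Phi>(x)h\<close> extends to an isometry, respectively a contraction, \<open>S\<close>,
  and \<open>W = W\<^sub>\<phi> S\<^sup>*\<close> is the second operator. In (iv), \<open>W = S\<^sub>\<Psi> W\<^sub>\<phi> S\<^sub>\<Phi>\<^sup>*\<close>.\<close>

section \<open>Bounded operators as bounded linear maps\<close>

lemma op_add: "op_apply T (x + y) = T x + T y"
  and op_scaleC: "op_apply T (a *\<^sub>C x) = a *\<^sub>C T x"
  using op_apply[of T] by (auto simp: clinear_iff)

lemma bounded_linear_op: "bounded_linear (op_apply T)"
proof -
  obtain K where "\<And>x. norm (T x) \<le> norm x * K"
    using op_apply[of T] by auto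
  then show ?thesis
    by (intro bounded_linear_intro[where K = K]) (simp_all add: op_add op_scaleC scaleR_scaleC)
qed

lemmas op_diff = linear_diff[OF bounded_linear.linear[OF bounded_linear_op]]
  and op_zero = linear_0[OF bounded_linear.linear[OF bounded_linear_op]]
  and op_sum = linear_sum[OF bounded_linear.linear[OF bounded_linear_op]]

lemma continuous_on_op: "continuous_on A (op_apply T)"
  by (intro linear_continuous_on bounded_linear_op)

lemma ex_bounded_op:
  fixes f :: "'a::complex_normed_vector \<Rightarrow> 'b::complex_normed_vector"
  assumes "\<And>x y. f (x + y) = f x + f y" "\<And>a x. f (a *\<^sub>C x) = a *\<^sub>C f x"
    and "\<And>x. norm (f x) \<le> norm x * K"
  shows "\<exists>T. op_apply T = f"
  using Bounded_Op_inverse[of f] assms by (auto simp: clinear_iff intro!: exI[of _ "Bounded_Op f"])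

lemma op_eq_iff: "S = T \<longleftrightarrow> (\<forall>x. op_apply S x = op_apply T x)"
  by (metis ext op_apply_inject)

lemmas op_eqI = op_eq_iff[THEN iffD2, rule_format]

lemma comp_op_apply [simp]: "op_apply (S o\<^sub>B T) x = S (T x)"
  by (simp add: comp_op.rep_eq)

lemma id_op_apply [simp]: "op_apply id_op x = x"
  by (simp add: id_op.rep_eq)

lemma minus_op_apply: "op_apply (S - T) x = S x - T x"
  unfolding minus_bounded_op_def plus_bounded_op.rep_eq uminus_bounded_op.rep_eq by simp

lemma sum_op_apply: "op_apply (\<Sum>i\<in>I. S i) x = (\<Sum>i\<in>I. op_apply (S i) x)"
  by (induction I rule: infinite_finite_induct)
     (simp_all add: zero_bounded_op.rep_eq plus_bounded_op.rep_eq)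


section \<open>The inner product\<close>

lemma cinner_add_left: "cinner (x + y) z = cinner x z + cinner y z"
  by (metis cinner_commute cinner_add_right complex_cnj_add)

lemma cinner_scaleC_left: "cinner (a *\<^sub>C x) y = cnj a * cinner x y"
  by (metis cinner_commute cinner_scaleC_right complex_cnj_mult)

lemma additive_cinner_right: "Modules.additive (cinner x)"
  by (simp add: Modules.additive_def cinner_add_right)

lemma additive_cinner_left: "Modules.additive (\<lambda>x. cinner x y)"
  by (simp add: Modules.additive_def cinner_add_left)

lemmas cinner_diff_right = Modules.additive.diff[OF additive_cinner_right]
  and cinner_zero_right = Modules.additive.zero[OF additive_cinner_right]
  and cinner_sum_right = Modules.additive.sum[OF additive_cinner_right]
  and cinner_diff_left = Modules.additive.diff[OF additive_cinner_left]
  and cinner_zero_left = Modules.additive.zero[OF additive_cinner_left]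
  and cinner_sum_left = Modules.additive.sum[OF additive_cinner_left]

text \<open>In the order on \<open>complex\<close>, \<open>0 \<le> z\<close> includes
  \<open>Im z = 0\<close>, so \<open>cinner x x\<close> is real and equal to its own
  modulus.\<close>

lemma cinner_self: "cinner x x = complex_of_real ((norm x)\<^sup>2)"
  using cinner_ge_zero[of x] norm_eq_sqrt_cinner[of x]
  by (simp add: less_eq_complex_def complex_eq_iff cmod_eq_Re)

lemma norm_add_sq: "(norm (x + y))\<^sup>2 = (norm x)\<^sup>2 + (norm y)\<^sup>2 + 2 * Re (cinner x y)"
proof -
  have "Re (cinner (x + y) (x + y)) = Re (cinner x x) + Re (cinner y y) + 2 * Re (cinner x y)"
    by (simp add: cinner_add_left cinner_add_right cinner_commute[of y x])
  then show ?thesis by (simp add: cinner_self)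
qed

lemma cauchy_schwarz: "cmod (cinner x y) \<le> norm x * norm y"
proof (cases "y = 0")
  case False
  \<comment> \<open>\<open>c *\<^sub>C y\<close> is the orthogonal projection of \<open>x\<close>
    onto the line spanned by \<open>y\<close>; the inequality says that the remainder has
    nonnegative squared norm.\<close>
  define c where "c = cinner y x / (norm y)\<^sup>2"
  have ny: "norm y \<noteq> 0" using False by simp
  have "cinner (x - c *\<^sub>C y) (x - c *\<^sub>C y)
      = (norm x)\<^sup>2 - c * cinner x y - cnj c * cinner y x + cnj c * c * (norm y)\<^sup>2"
    by (simp add: cinner_diff_left cinner_diff_right cinner_scaleC_left cinner_scaleC_right
        cinner_self[of x] cinner_self[of y] algebra_simps)
  also have "cinner x y = cnj (cinner y x)" by (rule cinner_commute)
  also have "(norm x)\<^sup>2 - c * cnj (cinner y x) - cnj c * cinner y x + cnj c * c * (norm y)\<^sup>2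
      = (norm x)\<^sup>2 - cinner y x * cnj (cinner y x) / (norm y)\<^sup>2"
    using ny by (simp add: c_def field_simps)
  also have "\<dots> = complex_of_real ((norm x)\<^sup>2 - (cmod (cinner y x))\<^sup>2 / (norm y)\<^sup>2)"
    using complex_norm_square[of "cinner y x"] by simp
  finally have "(norm (x - c *\<^sub>C y))\<^sup>2 = (norm x)\<^sup>2 - (cmod (cinner y x))\<^sup>2 / (norm y)\<^sup>2"
    unfolding cinner_self of_real_eq_iff .
  then have "(cmod (cinner y x))\<^sup>2 / (norm y)\<^sup>2 \<le> (norm x)\<^sup>2"
    by (smt (verit) zero_le_power2)
  then have "(cmod (cinner y x))\<^sup>2 \<le> (norm x * norm y)\<^sup>2"
    using ny by (simp add: divide_simps power_mult_distrib)
  then have "cmod (cinner y x) \<le> norm x * norm y"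
    by (rule power2_le_imp_le) simp
  then show ?thesis by (metis cinner_commute complex_mod_cnj)
qed (simp add: cinner_zero_right)

lemma cinner_eqI:
  assumes "\<And>z. cinner x z = cinner y z"
  shows "x = y"
  using assms[of "x - y"] cinner_eq_zero_iff[of "x - y"] by (simp add: cinner_diff_left)

text \<open>A nonzero \<open>x\<close> would have some \<open>y\<close> in \<open>A\<close> nearer
  to it than \<open>0\<close> is. Orthogonality makes \<open>cinner x (x - y)\<close> the squared
  norm of \<open>x\<close>, which Cauchy-Schwarz then forbids.\<close>

lemma dense_orthogonal_zero:
  assumes "closure A = UNIV" and "\<And>y. y \<in> A \<Longrightarrow> cinner x y = 0"
  shows "x = 0"
proof (rule ccontr)
  assume "x \<noteq> 0"
  then have "norm x > 0" by simp
  then obtain y where y: "y \<in> A" "norm (x - y) < norm x"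
    using assms(1) closure_approachable[of x A] by (metis UNIV_I dist_commute dist_norm)
  have "cinner x (x - y) = (norm x)\<^sup>2"
    using y assms(2) by (simp add: cinner_diff_right cinner_self)
  then have "norm x * norm x \<le> norm x * norm (x - y)"
    using cauchy_schwarz[of x "x - y"] by (simp add: power2_eq_square norm_mult)
  with \<open>norm x > 0\<close> y(2) show False by simp
qed

text \<open>First variation at a minimum, used to identify the minimiser in the Riesz
  theorem.\<close>

lemma quadratic_nonneg_imp_linear_zero:
  fixes a b :: real
  assumes "\<And>t. 0 \<le> t\<^sup>2 * a + 2 * t * b" and "a \<ge> 0"
  shows "b = 0"
proof (rule ccontr)
  assume "b \<noteq> 0"
  \<comment> \<open>For \<open>a > 0\<close> the minimum lies at \<open>- b / a\<close>; the
    denominator \<open>a + 1\<close> also covers \<open>a = 0\<close> and still gives a negative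
    value.\<close>
  define t where "t = - b / (a + 1)"
  have b: "b = - t * (a + 1)" using \<open>a \<ge> 0\<close> by (simp add: t_def)
  have "t\<^sup>2 * a + 2 * t * b = - (t\<^sup>2 * (a + 2))"
    by (simp add: b algebra_simps power2_eq_square)
  moreover have "t\<^sup>2 * (a + 2) > 0" using \<open>b \<noteq> 0\<close> b \<open>a \<ge> 0\<close> by auto
  ultimately show False using assms(1)[of t] by linarith
qed

text \<open>The representing vector minimises \<open>\<parallel>x\<parallel>\<^sup>2 - 2 Re f(x)\<close>; the parallelogram law makes
  minimising sequences Cauchy.\<close>

lemma riesz_representation:
  fixes f :: "'a::chilbert_space \<Rightarrow> complex"
  assumes add: "\<And>x y. f (x + y) = f x + f y" and scale: "\<And>a x. f (a *\<^sub>C x) = a * f x"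
    and bound: "\<And>x. cmod (f x) \<le> norm x * K"
  shows "\<exists>y. \<forall>x. f x = cinner y x"
proof -
  define J where "J x = (norm x)\<^sup>2 - 2 * Re (f x)" for x
  define m where "m = Inf (range J)"
  have bl: "bounded_linear f"
    using add scale bound
    by (intro bounded_linear_intro[where K = K]) (simp_all add: scaleR_scaleC scaleR_conv_of_real)
  \<comment> \<open>Completing the square: \<open>J x\<close> is at least
    \<open>(norm x)^2 - 2 * K * norm x\<close>.\<close>
  have "- K\<^sup>2 \<le> J x" for x
    using bound[of x] complex_Re_le_cmod[of "f x"] zero_le_power2[of "norm x - K"]
    by (simp add: J_def power2_diff mult.commute)
  then have bdd: "bdd_below (range J)" by (auto intro!: bdd_belowI)
  have m_le: "m \<le> J x" for x
    unfolding m_def using bdd by (simp add: cInf_lower)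
  have "\<exists>x. J x < m + 1 / real (Suc n)" for n
    using cInf_lessD[of "range J" "m + 1 / real (Suc n)"] by (auto simp: m_def)
  then obtain a where a: "J (a n) < m + 1 / real (Suc n)" for n by metis
  have par: "(norm (x - y))\<^sup>2 \<le> 2 * (J x + J y - 2 * m)" for x y
  proof -
    define p q where "p = (1/2) *\<^sub>R (x + y)" and "q = (1/2) *\<^sub>R (x - y)"
    \<comment> \<open>The minus sign is written as a complex scalar so that \<open>scale\<close> and
      \<open>cinner_scaleC_right\<close> apply. The parallelogram law compares \<open>x\<close> and
      \<open>y\<close> with their midpoint \<open>p\<close>, where \<open>J p\<close> is at least
      \<open>m\<close>.\<close>
    have x: "x = p + q" and y: "y = p + (- 1) *\<^sub>C q" and xy: "x - y = 2 *\<^sub>R q"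
      by (simp_all add: p_def q_def algebra_simps scaleR_scaleC[of "-1", simplified, symmetric]
          flip: scaleR_add_left)
    have "J x + J y = 2 * J p + 2 * (norm q)\<^sup>2"
      by (simp add: J_def x y norm_add_sq norm_scaleC add scale cinner_scaleC_right)
    moreover have "(norm (x - y))\<^sup>2 = 4 * (norm q)\<^sup>2"
      by (simp add: xy power_mult_distrib)
    ultimately show ?thesis using m_le[of p] by simp
  qed
  have "Cauchy a"
  proof (rule metric_CauchyI)
    fix e :: real assume "e > 0"
    \<comment> \<open>Each term may exceed \<open>m\<close> by less than \<open>e^2 / 4\<close>,
      because \<open>par\<close> doubles the sum of the two excesses.\<close>
    then obtain N where N: "inverse (real (Suc N)) < e\<^sup>2 / 4"
      using reals_Archimedean[of "e\<^sup>2 / 4"] by auto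
    have "dist (a i) (a j) < e" if "i \<ge> N" "j \<ge> N" for i j
    proof -
      have J_a: "J (a k) < m + e\<^sup>2 / 4" if "k \<ge> N" for k
      proof -
        have "1 / real (Suc k) \<le> inverse (real (Suc N))"
          using that by (simp add: divide_simps)
        then have "1 / real (Suc k) < e\<^sup>2 / 4" using N by (rule le_less_trans)
        then show ?thesis using a[of k] by linarith
      qed
      have "(norm (a i - a j))\<^sup>2 < e\<^sup>2"
        using par[of "a i" "a j"] J_a[OF that(1)] J_a[OF that(2)] by (simp add: field_simps)
      then show ?thesis using \<open>e > 0\<close> by (simp add: dist_norm power2_less_imp_less)
    qed
    then show "\<exists>N. \<forall>i\<ge>N. \<forall>j\<ge>N. dist (a i) (a j) < e" by blast
  qed
  then obtain l where l: "a \<longlonglongrightarrow> l" using Cauchy_convergent convergent_def by blast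
  have "(\<lambda>n. J (a n)) \<longlonglongrightarrow> J l"
    unfolding J_def by (intro tendsto_intros l bounded_linear.tendsto[OF bl])
  moreover have "(\<lambda>n. m + 1 / real (Suc n)) \<longlonglongrightarrow> m + 0"
    using LIMSEQ_inverse_real_of_nat by (intro tendsto_intros) (simp add: inverse_eq_divide)
  ultimately have Jl: "J l \<le> m"
    using a by (intro LIMSEQ_le[where X = "\<lambda>n. J (a n)" and x = "J l" and y = m]) (auto intro: less_imp_le)
  \<comment> \<open>Since \<open>l\<close> minimises \<open>J\<close>, the comparison with
    \<open>l + t x\<close> for real \<open>t\<close> leaves no linear term in
    \<open>t\<close>.\<close>
  have Re: "Re (cinner l x) = Re (f x)" for x
  proof -
    have "0 \<le> t\<^sup>2 * (norm x)\<^sup>2 + 2 * t * (Re (cinner l x) - Re (f x))" for t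
      using Jl m_le[of "l + complex_of_real t *\<^sub>C x"]
      by (simp add: J_def norm_add_sq norm_scaleC add scale cinner_scaleC_right algebra_simps)
    from quadratic_nonneg_imp_linear_zero[OF this] show ?thesis by simp
  qed
  \<comment> \<open>Passing from \<open>x\<close> to \<open>\<i> *\<^sub>C x\<close> turns the
    identity of real parts into that of imaginary parts.\<close>
  have "f x = cinner l x" for x
    using Re[of x] Re[of "\<i> *\<^sub>C x"] by (simp add: complex_eq_iff scale cinner_scaleC_right)
  then show ?thesis by blast
qed


section \<open>Adjoints, isometries and unitaries\<close>

text \<open>For each \<open>x\<close>, Riesz represents the functional sending \<open>y\<close> to
  \<open>cinner x (T y)\<close>. The representing vector \<open>f x\<close> is linear in
  \<open>x\<close> by uniqueness, and pairing it with itself bounds its norm.\<close>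

lemma ex_adj:
  fixes T :: "'a::chilbert_space \<Rightarrow>\<^sub>B 'b::chilbert_space"
  shows "\<exists>S :: 'b \<Rightarrow>\<^sub>B 'a. \<forall>x y. cinner (S x) y = cinner x (T y)"
proof -
  obtain K where K: "K > 0" "\<And>x. norm (T x) \<le> norm x * K"
    using bounded_linear.pos_bounded[OF bounded_linear_op[of T]] by auto
  have bound: "cmod (cinner x (T y)) \<le> norm y * (norm x * K)" for x y
    using cauchy_schwarz[of x "T y"] mult_left_mono[OF K(2)[of y] norm_ge_zero[of x]]
    by (simp add: mult_ac)
  have "\<exists>z. \<forall>y. cinner x (T y) = cinner z y" for x
    by (rule riesz_representation[OF _ _ bound[of x]])
       (simp_all add: op_add op_scaleC cinner_add_right cinner_scaleC_right)
  then obtain f where f: "cinner (f x) y = cinner x (T y)" for x y by metis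
  have "norm (f x) \<le> norm x * K" for x
  proof (cases "f x = 0")
    case False
    have "norm (f x) * norm (f x) = cmod (cinner x (T (f x)))"
      by (simp add: cinner_self power2_eq_square norm_mult flip: f)
    also have "\<dots> \<le> norm (f x) * (norm x * K)" by (rule bound)
    finally show ?thesis using False by simp
  qed (use K in simp)
  moreover have "f (x + y) = f x + f y" for x y
    by (rule cinner_eqI) (simp add: f cinner_add_left)
  moreover have "f (a *\<^sub>C x) = a *\<^sub>C f x" for a x
    by (rule cinner_eqI) (simp add: f cinner_scaleC_left)
  ultimately obtain S where "op_apply S = f" using ex_bounded_op by blast
  with f show ?thesis by auto
qed

text \<open>Since \<open>adj\<close> is a definite description, its characteristic equation takes
  uniqueness besides \<open>ex_adj\<close>; \<open>cinner_eqI\<close> supplies it.\<close>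

lemma cinner_adj_left: "cinner (adj T x) y = cinner x (T y)"
proof -
  have "\<exists>!S. \<forall>x y. cinner (op_apply S x) y = cinner x (T y)"
    by (rule ex_ex1I[OF ex_adj]) (metis cinner_eqI op_eqI)
  from theI'[OF this] show ?thesis by (simp add: adj_def)
qed

lemma cinner_adj_right: "cinner x (adj T y) = cinner (T x) y"
  by (metis cinner_adj_left cinner_commute)

lemma adj_eqI: "(\<And>x y. cinner (op_apply S x) y = cinner x (op_apply T y)) \<Longrightarrow> adj T = S"
  by (intro op_eqI cinner_eqI) (simp add: cinner_adj_left)

lemma adj_adj [simp]: "adj (adj T) = T"
  by (intro adj_eqI) (simp add: cinner_adj_right)

lemma adj_comp: "adj (S o\<^sub>B T) = adj T o\<^sub>B adj S"
  by (intro adj_eqI) (simp add: cinner_adj_left)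

lemma norm_op_sq: "complex_of_real ((norm (op_apply T x))\<^sup>2) = cinner x (adj T (T x))"
  by (simp add: cinner_adj_right cinner_self)

text \<open>Polarisation: norms determine the real parts of inner products, and a factor
  \<open>\<i>\<close> gives the imaginary parts. The algebraic form suits calculations with
  adjoints.\<close>

lemma isometry_op_iff: "isometry_op T \<longleftrightarrow> (\<forall>x. adj T (T x) = x)"
proof
  assume T: "isometry_op T"
  have Re: "Re (cinner (T x) (T y)) = Re (cinner x y)" for x y
    using T norm_add_sq[of x y] norm_add_sq[of "T x" "T y"]
    by (simp add: isometry_op_def flip: op_add)
  have "cinner (T x) (T y) = cinner x y" for x y
    using Re[of x y] Re[of x "\<i> *\<^sub>C y"]
    by (simp add: complex_eq_iff op_scaleC cinner_scaleC_right)
  then show "\<forall>x. adj T (T x) = x"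
    by (intro allI cinner_eqI) (simp add: cinner_adj_left)
next
  assume "\<forall>x. adj T (T x) = x"
  then have "(norm (T x))\<^sup>2 = (norm x)\<^sup>2" for x
    using norm_op_sq[of T x] by (simp only: cinner_self of_real_eq_iff)
  then show "isometry_op T" by (simp add: isometry_op_def)
qed

lemma coisometry_op_iff: "coisometry_op T \<longleftrightarrow> (\<forall>y. T (adj T y) = y)"
  by (simp add: coisometry_op_def isometry_op_iff)

lemma unitary_op_iff: "unitary_op T \<longleftrightarrow> isometry_op T \<and> coisometry_op T"
  by (simp add: unitary_op_def isometry_op_iff coisometry_op_iff op_eq_iff)

lemma isometry_op_comp: "isometry_op S \<Longrightarrow> isometry_op T \<Longrightarrow> isometry_op (S o\<^sub>B T)"
  by (simp add: isometry_op_def)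

lemma unitary_op_comp: "unitary_op S \<Longrightarrow> unitary_op T \<Longrightarrow> unitary_op (S o\<^sub>B T)"
  by (simp add: unitary_op_iff coisometry_op_def adj_comp isometry_op_comp)

lemma unitary_op_adj: "unitary_op T \<Longrightarrow> unitary_op (adj T)"
  by (simp add: unitary_op_def)

text \<open>The kernel of \<open>adj S\<close> is orthogonal to the range of
  \<open>S\<close>.\<close>

lemma dense_range_imp_inj_adj:
  assumes "dense_range S"
  shows "inj (op_apply (adj S))"
proof (rule injI)
  fix x y assume "adj S x = adj S y"
  then have "cinner (x - y) (S z) = 0" for z
    by (simp add: op_diff flip: cinner_adj_left) (simp add: cinner_zero_left)
  then have "x - y = 0"
    using assms dense_orthogonal_zero[of "range S" "x - y"] by (auto simp: dense_range_def)
  then show "x = y" by simp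
qed

text \<open>\<open>adj S\<close> sends \<open>S (adj S y)\<close> and \<open>y\<close> to the same
  vector, and density of the range makes it injective.\<close>

lemma isometry_dense_range_unitary:
  assumes "isometry_op S" "dense_range S"
  shows "unitary_op S"
proof -
  have "S (adj S y) = y" for y
    by (rule injD[OF dense_range_imp_inj_adj[OF assms(2)]])
       (use assms(1) in \<open>simp add: isometry_op_iff\<close>)
  with assms(1) show ?thesis by (simp add: unitary_op_iff coisometry_op_iff)
qed

lemma unitary_imp_dense_range: "unitary_op S \<Longrightarrow> dense_range S"
  by (metis closure_UNIV coisometry_op_iff dense_range_def surj_def unitary_op_iff)

lemma contraction_op_adj:
  assumes "contraction_op T"
  shows "contraction_op (adj T)"
  unfolding contraction_op_def
proof
  fix x
  have "norm (adj T x) * norm (adj T x) = cmod (cinner x (T (adj T x)))"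
    by (simp add: cinner_self power2_eq_square norm_mult flip: cinner_adj_left)
  also have "\<dots> \<le> norm x * norm (T (adj T x))" by (rule cauchy_schwarz)
  also have "\<dots> \<le> norm x * norm (adj T x)"
    using assms by (simp add: contraction_op_def mult_left_mono)
  finally show "norm (adj T x) \<le> norm x"
    by (cases "adj T x = 0") simp_all
qed

text \<open>\<open>W\<close> kills \<open>x - adj W (W x)\<close> because \<open>adj W\<close> is a
  right inverse of \<open>W\<close>. A vector \<open>x\<close> orthogonal to the kernel is therefore
  orthogonal to this difference, so \<open>W\<close> preserves its norm.\<close>

lemma partial_isometry_op_comp:
  assumes "isometry_op S" "coisometry_op W"
  shows "partial_isometry_op (S o\<^sub>B W)"
  unfolding partial_isometry_op_def
proof (intro allI impI)
  fix x assume x: "\<forall>y. (S o\<^sub>B W) y = 0 \<longrightarrow> cinner y x = 0"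
  have "cinner (x - adj W (W x)) x = 0"
    using x assms(2) by (simp add: op_diff op_zero coisometry_op_iff)
  then have "(norm (W x))\<^sup>2 = (norm x)\<^sup>2"
    by (simp add: cinner_diff_left cinner_adj_left cinner_self flip: of_real_power)
  with assms(1) show "norm ((S o\<^sub>B W) x) = norm x"
    by (simp add: isometry_op_def)
qed


section \<open>Extending contractions from total sets\<close>

lemma module_scaleC: "module (scaleC :: complex \<Rightarrow> 'a::complex_vector \<Rightarrow> 'a)"
  by (simp add: module_iff_vector_space vector_space_scaleC)

lemma subspace_scaleC_iff:
  "module.subspace scaleC A \<longleftrightarrow>
    0 \<in> A \<and> (\<forall>x\<in>A. \<forall>y\<in>A. x + y \<in> A) \<and> (\<forall>a. \<forall>x\<in>A. a *\<^sub>C x \<in> A)"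
  by (rule module.subspace_def[OF module_scaleC])

lemma bounded_linear_scaleC: "bounded_linear (\<lambda>x :: 'a::complex_normed_vector. c *\<^sub>C x)"
  by (intro bounded_linear_intro[where K = "cmod c"])
     (simp_all add: scaleC_add_right scaleR_scaleC scaleC_scaleC mult.commute norm_scaleC)

text \<open>A relation replaces a function because a vector may be written as a combination of
  generators in several ways. Linearity and \<open>bound\<close> together make the value unique and
  let it pass to limits.\<close>

lemma extend_contractive_relation:
  fixes P :: "'a::chilbert_space \<Rightarrow> 'b::chilbert_space \<Rightarrow> bool"
  assumes add: "\<And>x y x' y'. P x y \<Longrightarrow> P x' y' \<Longrightarrow> P (x + x') (y + y')"
    and scale: "\<And>c x y. P x y \<Longrightarrow> P (c *\<^sub>C x) (c *\<^sub>C y)"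
    and bound: "\<And>x y. P x y \<Longrightarrow> norm y \<le> norm x"
    and dense: "closure {x. \<exists>y. P x y} = UNIV"
  shows "\<exists>T. contraction_op T \<and> (\<forall>x y. P x y \<longrightarrow> op_apply T x = y)"
proof -
  \<comment> \<open>\<open>R\<close> is the closure of the graph of \<open>P\<close>; it turns out
    to be the graph of the operator.\<close>
  define R where "R x y \<longleftrightarrow> (\<exists>u v. (\<forall>n. P (u n) (v n)) \<and> u \<longlonglongrightarrow> x \<and> v \<longlonglongrightarrow> y)" for x y
  have RI: "R x y" if "\<And>n. P (u n) (v n)" "u \<longlonglongrightarrow> x" "v \<longlonglongrightarrow> y" for u v x y
    unfolding R_def by (intro exI[of _ u] exI[of _ v] conjI allI that)
  have R_add: "R (x + x') (y + y')" if "R x y" "R x' y'" for x y x' y'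
  proof -
    obtain u v where uv: "\<forall>n. P (u n) (v n)" "u \<longlonglongrightarrow> x" "v \<longlonglongrightarrow> y"
      using \<open>R x y\<close> unfolding R_def by blast
    obtain u' v' where uv': "\<forall>n. P (u' n) (v' n)" "u' \<longlonglongrightarrow> x'" "v' \<longlonglongrightarrow> y'"
      using \<open>R x' y'\<close> unfolding R_def by blast
    show ?thesis
      by (intro RI[of "\<lambda>n. u n + u' n" "\<lambda>n. v n + v' n"] add tendsto_add uv uv'
          uv(1)[rule_format] uv'(1)[rule_format])
  qed
  have R_scale: "R (c *\<^sub>C x) (c *\<^sub>C y)" if "R x y" for c x y
  proof -
    obtain u v where uv: "\<forall>n. P (u n) (v n)" "u \<longlonglongrightarrow> x" "v \<longlonglongrightarrow> y"
      using \<open>R x y\<close> unfolding R_def by blast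
    show ?thesis
      by (intro RI[of "\<lambda>n. c *\<^sub>C u n" "\<lambda>n. c *\<^sub>C v n"] scale uv(1)[rule_format]
          bounded_linear.tendsto[OF bounded_linear_scaleC] uv)
  qed
  have R_bound: "norm y \<le> norm x" if "R x y" for x y
  proof -
    obtain u v where uv: "\<forall>n. P (u n) (v n)" "u \<longlonglongrightarrow> x" "v \<longlonglongrightarrow> y"
      using \<open>R x y\<close> unfolding R_def by blast
    show ?thesis
      by (rule LIMSEQ_le[OF uv(3,2)[THEN tendsto_norm]]) (use bound uv(1) in blast)
  qed
  \<comment> \<open>Stated for an arbitrary \<open>Q\<close>: with \<open>P\<close> it makes the
    image sequences Cauchy, with \<open>R\<close> it gives uniqueness of the image.\<close>
  have diff: "norm (y - y') \<le> norm (x - x')"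
    if "Q x y" "Q x' y'"
      "\<And>x y x' y'. Q x y \<Longrightarrow> Q x' y' \<Longrightarrow> Q (x + x') (y + y')"
      "\<And>c x y. Q x y \<Longrightarrow> Q (c *\<^sub>C x) (c *\<^sub>C y)" "\<And>x y. Q x y \<Longrightarrow> norm y \<le> norm x"
    for Q :: "'a \<Rightarrow> 'b \<Rightarrow> bool" and x y x' y'
  proof -
    have "Q (x + (- 1) *\<^sub>C x') (y + (- 1) *\<^sub>C y')" by (intro that)
    from that(5)[OF this] show ?thesis
      by (simp add: scaleR_scaleC[of "-1", simplified, symmetric])
  qed
  have "\<exists>y. R x y" for x
  proof -
    have "x \<in> closure {x. \<exists>y. P x y}" using dense by simp
    then obtain u where "\<forall>n. \<exists>y. P (u n) y" and u: "u \<longlonglongrightarrow> x"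
      unfolding closure_sequential by auto
    then obtain v where v: "\<And>n. P (u n) (v n)" by metis
    have "norm (v i - v j) \<le> norm (u i - u j)" for i j
      by (rule diff[of P, OF v v add scale bound])
    moreover have "Cauchy u" using u by (rule LIMSEQ_imp_Cauchy)
    ultimately have "Cauchy v"
      unfolding Cauchy_def dist_norm by (meson le_less_trans)
    then obtain y where "v \<longlonglongrightarrow> y" using Cauchy_convergent convergent_def by blast
    then show ?thesis using RI[OF v u] by blast
  qed
  then obtain f where f: "R x (f x)" for x by metis
  have unique: "y = f x" if "R x y" for x y
    using diff[of R, OF that f[of x] R_add R_scale R_bound] by simp
  have "\<exists>T. op_apply T = f"
  proof (rule ex_bounded_op)
    show "f (x + y) = f x + f y" for x y by (rule sym, rule unique, rule R_add[OF f f])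
    show "f (a *\<^sub>C x) = a *\<^sub>C f x" for a x by (rule sym, rule unique, rule R_scale[OF f])
    show "norm (f x) \<le> norm x * 1" for x using R_bound[OF f] by simp
  qed
  then obtain T where T: "op_apply T = f" by blast
  \<comment> \<open>Constant sequences show that \<open>R\<close> contains \<open>P\<close>.\<close>
  have "op_apply T x = y" if "P x y" for x y
    unfolding T by (rule unique[symmetric], rule RI[of "\<lambda>_. x" "\<lambda>_. y"]) (simp_all add: that)
  then show ?thesis
    using R_bound[OF f] by (intro exI[of _ T]) (simp add: contraction_op_def T)
qed

section \<open>Density arguments for non-degenerate maps\<close>

lemma closed_cspan_mono_subspace:
  assumes "module.subspace scaleC B" "A \<subseteq> B"
  shows "closed_cspan A \<subseteq> closure B"
  unfolding closed_cspan_def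
  by (intro closure_mono module.span_minimal[OF module_scaleC] assms)

text \<open>This replaces induction over spans: a property that defines a subspace needs checking
  only on the vectors \<open>\<Phi> x h\<close>.\<close>

lemma nondegenerate_dense_subspace:
  assumes "nondegenerate \<Phi>" and "module.subspace scaleC A" and "\<And>x h. op_apply (\<Phi> x) h \<in> A"
  shows "closure A = UNIV"
  using closed_cspan_mono_subspace[OF assms(2), of "{\<Phi> x h | x h. True}"] assms(1,3)
  by (auto simp: nondegenerate_def)

lemma nondegenerate_eqI:
  assumes "nondegenerate \<Phi>" and "\<And>x h. cinner u (op_apply (\<Phi> x) h) = cinner v (\<Phi> x h)"
  shows "u = v"
proof -
  have "closure {z. cinner (u - v) z = 0} = UNIV"
    using assms(2)
    by (intro nondegenerate_dense_subspace[OF assms(1)])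
       (auto simp: subspace_scaleC_iff cinner_zero_right cinner_add_right cinner_scaleC_right
          cinner_diff_left)
  from dense_orthogonal_zero[OF this, of "u - v"] show ?thesis by simp
qed

text \<open>The maps need not be linear in \<open>x\<close>, so the linear structure comes from
  formal sums: \<open>P\<close> pairs the two sums given by one list of pairs \<open>(x, h)\<close>.
  Lists are added by concatenation and scaled in the entries \<open>h\<close>.\<close>

lemma extend_nondegenerate:
  fixes \<Phi>\<^sub>0 :: "'e \<Rightarrow> 'h::chilbert_space \<Rightarrow>\<^sub>B 'k::chilbert_space"
    and \<Phi> :: "'e \<Rightarrow> 'h \<Rightarrow>\<^sub>B 'l::chilbert_space"
  assumes nondeg: "nondegenerate \<Phi>\<^sub>0"
    and bound: "\<And>n x h. norm (\<Sum>j<n. \<Phi> (x j) (h j)) \<le> norm (\<Sum>j<n::nat. \<Phi>\<^sub>0 (x j) (h j))"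
  shows "\<exists>S. contraction_op S \<and> (\<forall>x. S o\<^sub>B \<Phi>\<^sub>0 x = \<Phi> x)"
proof -
  define C\<^sub>0 where "C\<^sub>0 l = (\<Sum>(x, h)\<leftarrow>l. \<Phi>\<^sub>0 x h)" for l
  define C where "C l = (\<Sum>(x, h)\<leftarrow>l. \<Phi> x h)" for l
  define P where "P u v \<longleftrightarrow> (\<exists>l. u = C\<^sub>0 l \<and> v = C l)" for u v
  have scale: "C\<^sub>0 (map (\<lambda>(x, h). (x, c *\<^sub>C h)) l) = c *\<^sub>C C\<^sub>0 l"
    "C (map (\<lambda>(x, h). (x, c *\<^sub>C h)) l) = c *\<^sub>C C l" for c l
    by (induction l) (auto simp: C\<^sub>0_def C_def op_scaleC scaleC_add_right scaleC_zero_right)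
  have P_add: "P (u + u') (v + v')" if uv: "P u v" "P u' v'" for u v u' v'
  proof -
    from uv obtain l l' where "u = C\<^sub>0 l" "v = C l" "u' = C\<^sub>0 l'" "v' = C l'"
      unfolding P_def by blast
    then show ?thesis
      unfolding P_def by (intro exI[of _ "l @ l'"]) (simp add: C\<^sub>0_def C_def)
  qed
  have P_scale: "P (c *\<^sub>C u) (c *\<^sub>C v)" if uv: "P u v" for c u v
    using uv unfolding P_def by (metis scale)
  have P_bound: "norm v \<le> norm u" if uv: "P u v" for u v
  proof -
    from uv obtain l where "u = C\<^sub>0 l" "v = C l" unfolding P_def by blast
    then show ?thesis
      using bound[of "\<lambda>j. fst (l ! j)" "\<lambda>j. snd (l ! j)" "length l"]
      by (simp add: C\<^sub>0_def C_def sum_list_sum_nth case_prod_beta atLeast0LessThan)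
  qed
  have generator: "P (\<Phi>\<^sub>0 x h) (\<Phi> x h)" for x h
    unfolding P_def by (intro exI[of _ "[(x, h)]"]) (simp add: C\<^sub>0_def C_def)
  have "P 0 0"
    unfolding P_def by (intro exI[of _ "[]"]) (simp add: C\<^sub>0_def C_def)
  then have "module.subspace scaleC {u. \<exists>v. P u v}"
    unfolding subspace_scaleC_iff using P_add P_scale by blast
  then have "closure {u. \<exists>v. P u v} = UNIV"
    using nondegenerate_dense_subspace[OF nondeg] generator by blast
  from extend_contractive_relation[of P, OF P_add P_scale P_bound this]
  show ?thesis using generator by (auto simp: op_eq_iff)
qed

lemma nondegenerate_imp_dense_range:
  assumes "nondegenerate \<Phi>" and "\<And>x. S o\<^sub>B \<Phi>\<^sub>0 x = \<Phi> x"
  shows "dense_range S"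
  unfolding dense_range_def
proof (rule nondegenerate_dense_subspace[OF assms(1)])
  show "module.subspace scaleC (range (op_apply S))"
    unfolding subspace_scaleC_iff
    by (auto simp flip: op_add op_scaleC) (metis op_zero rangeI)
  show "op_apply (\<Phi> x) h \<in> range (op_apply S)" for x h
    by (simp flip: assms(2))
qed

text \<open>The preimage under \<open>S\<close> of the span \<open>B\<close> is a subspace
  containing every \<open>\<Phi>\<^sub>0 x h\<close>, hence dense. Continuity then puts the range of
  \<open>S\<close> into the closure of \<open>B\<close>.\<close>

lemma dense_range_imp_nondegenerate:
  fixes \<Phi> :: "'e \<Rightarrow> 'h::chilbert_space \<Rightarrow>\<^sub>B 'k::chilbert_space"
  assumes "nondegenerate \<Phi>\<^sub>0" and "dense_range S" and S: "\<And>x. S o\<^sub>B \<Phi>\<^sub>0 x = \<Phi> x"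
  shows "nondegenerate \<Phi>"
proof -
  define B where "B = module.span scaleC {\<Phi> x h | x h. True}"
  have B: "module.subspace scaleC B"
    unfolding B_def by (rule module.subspace_span[OF module_scaleC])
  have "\<Phi> x h \<in> B" for x h
    unfolding B_def by (rule module.span_base[OF module_scaleC]) blast
  then have "S (\<Phi>\<^sub>0 x h) \<in> B" for x h
    by (simp flip: S)
  then have "closure {u. S u \<in> B} = UNIV"
    using B by (intro nondegenerate_dense_subspace[OF assms(1)])
      (auto simp: subspace_scaleC_iff op_add op_scaleC op_zero)
  moreover have "op_apply S ` closure {u. S u \<in> B} \<subseteq> closure B"
    by (rule image_closure_subset[OF continuous_on_op closed_closure])
       (use closure_subset in blast)
  ultimately have "closure (range S) \<subseteq> closure B"
    by (simp add: closure_minimal)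
  with assms(2) show ?thesis
    by (auto simp: nondegenerate_def closed_cspan_def B_def dense_range_def)
qed


section \<open>Maps dominated by a completely positive map\<close>

text \<open>Gram expansion: the norm of the sum depends on the operators only through the products
  \<open>adj (T i) o\<^sub>B T j\<close>, which is what \<open>theta_map\<close> prescribes.\<close>

lemma norm_sum_op_sq:
  "complex_of_real ((norm (\<Sum>j\<in>J. op_apply (T j) (h j)))\<^sup>2)
    = (\<Sum>i\<in>J. \<Sum>j\<in>J. cinner (h i) (adj (T i) (T j (h j))))"
  by (subst sum.swap) (simp add: cinner_self[symmetric] cinner_sum_left cinner_sum_right cinner_adj_right del: of_real_power)

lemma theta_map_isometry_comp:
  assumes "theta_map ip \<theta> \<Phi>\<^sub>0" "isometry_op S" "\<And>x. S o\<^sub>B \<Phi>\<^sub>0 x = \<Phi> x"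
  shows "theta_map ip \<theta> \<Phi>"
  using assms(1,2)
  by (simp add: theta_map_def op_eq_iff isometry_op_iff adj_comp flip: assms(3))

lemma theta_map_adj: "theta_map ip \<theta> \<Phi> \<Longrightarrow> adj (\<Phi> x) (\<Phi> y h) = \<theta> (ip x y) h"
  by (simp add: theta_map_def op_eq_iff)

lemma theta_maps_isometry:
  assumes \<Phi>\<^sub>0: "theta_map ip \<theta> \<Phi>\<^sub>0" "nondegenerate \<Phi>\<^sub>0" and \<Phi>: "theta_map ip \<theta> \<Phi>"
  shows "\<exists>S. isometry_op S \<and> (\<forall>x. S o\<^sub>B \<Phi>\<^sub>0 x = \<Phi> x)"
proof -
  have "complex_of_real ((norm (\<Sum>j<n. \<Phi> (x j) (h j)))\<^sup>2)
      = complex_of_real ((norm (\<Sum>j<n. \<Phi>\<^sub>0 (x j) (h j)))\<^sup>2)" for n :: nat and x h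
    by (simp only: norm_sum_op_sq theta_map_adj[OF \<Phi>] theta_map_adj[OF \<Phi>\<^sub>0(1)])
  then have "norm (\<Sum>j<n. \<Phi> (x j) (h j)) \<le> norm (\<Sum>j<n. \<Phi>\<^sub>0 (x j) (h j))" for n :: nat and x h
    unfolding of_real_eq_iff by simp
  from extend_nondegenerate[OF \<Phi>\<^sub>0(2) this]
  obtain S where S: "\<And>x. S o\<^sub>B \<Phi>\<^sub>0 x = \<Phi> x" by blast
  have S_apply: "S (\<Phi>\<^sub>0 x h) = \<Phi> x h" for x h
    by (simp flip: S)
  \<comment> \<open>Tested against \<open>\<Phi>\<^sub>0 y k\<close>, both sides reduce to
    \<open>\<theta>\<close> of the same inner product.\<close>
  have "adj S (S (\<Phi>\<^sub>0 x h)) = \<Phi>\<^sub>0 x h" for x h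
    by (rule nondegenerate_eqI[OF \<Phi>\<^sub>0(2)])
       (simp add: cinner_adj_left S_apply flip: cinner_adj_right,
        simp add: theta_map_adj[OF \<Phi>] theta_map_adj[OF \<Phi>\<^sub>0(1)])
  \<comment> \<open>The fixed vectors of \<open>adj S o\<^sub>B S\<close> form a closed subspace, so
    density makes every vector fixed.\<close>
  then have "closure {u. adj S (S u) = u} = UNIV"
    by (intro nondegenerate_dense_subspace[OF \<Phi>\<^sub>0(2)])
       (auto simp: subspace_scaleC_iff op_add op_scaleC op_zero)
  moreover have "closed {u. adj S (S u) = u}"
    using continuous_on_op[of UNIV "adj S o\<^sub>B S"]
    by (intro closed_Collect_eq continuous_on_id) simp
  ultimately show ?thesis
    using S by (auto simp: isometry_op_iff closure_closed)
qed

text \<open>With all rows equal to \<open>x\<close>, the defining matrix inequality becomes \<open>n\<close> times the inequality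
  for the row \<open>x\<close>; no value of \<open>\<Phi>\<close> at \<open>0\<close> is needed.\<close>

lemma completely_semi_map_iff:
  fixes \<theta> :: "'a::cstar_algebra \<Rightarrow> 'h::chilbert_space \<Rightarrow>\<^sub>B 'h"
  assumes "clinear \<theta>" and \<Phi>\<^sub>0: "theta_map ip \<theta> \<Phi>\<^sub>0"
  shows "completely_semi_map ip \<theta> \<Phi> \<longleftrightarrow>
    (\<forall>n x h. norm (\<Sum>j<n. \<Phi> (x j) (h j)) \<le> norm (\<Sum>j<n::nat. \<Phi>\<^sub>0 (x j) (h j)))"
proof -
  \<comment> \<open>The defect of a single row \<open>x\<close>. Below, the quadratic form of the
    matrix difference splits into the defects of the rows \<open>x k\<close>.\<close>
  define d where "d n x h = (norm (\<Sum>j<n. \<Phi>\<^sub>0 (x j) (h j)))\<^sup>2 - (norm (\<Sum>j<n::nat. \<Phi> (x j) (h j)))\<^sup>2"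
    for n x h
  have "Modules.additive \<theta>" using assms(1) by (simp add: Modules.additive_def clinear_iff)
  note \<theta>_sum = Modules.additive.sum[OF this]
  have "(\<Sum>i<n. \<Sum>j<n. cinner (h i) ((entrywise \<theta> (mat_ip ip n x x) i j
      - op_mat_mult n (op_mat_adj (entrywise \<Phi> x)) (entrywise \<Phi> x) i j) (h j)))
    = complex_of_real (\<Sum>k<n. d n (x k) h)" (is "?L = ?R") for n x h
  proof -
    have "?L = (\<Sum>i<n. \<Sum>j<n. \<Sum>k<n. cinner (h i) (adj (\<Phi>\<^sub>0 (x k i)) (\<Phi>\<^sub>0 (x k j) (h j)))
        - cinner (h i) (adj (\<Phi> (x k i)) (\<Phi> (x k j) (h j))))"
      by (simp add: entrywise_def mat_ip_def op_mat_mult_def op_mat_adj_def minus_op_apply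
          sum_op_apply \<theta>_sum cinner_diff_right cinner_sum_right sum_subtractf theta_map_adj[OF \<Phi>\<^sub>0])
    also have "\<dots> = (\<Sum>i<n. \<Sum>k<n. \<Sum>j<n. cinner (h i) (adj (\<Phi>\<^sub>0 (x k i)) (\<Phi>\<^sub>0 (x k j) (h j)))
        - cinner (h i) (adj (\<Phi> (x k i)) (\<Phi> (x k j) (h j))))"
      by (rule sum.cong[OF refl]) (rule sum.swap)
    also have "\<dots> = (\<Sum>k<n. \<Sum>i<n. \<Sum>j<n. cinner (h i) (adj (\<Phi>\<^sub>0 (x k i)) (\<Phi>\<^sub>0 (x k j) (h j)))
        - cinner (h i) (adj (\<Phi> (x k i)) (\<Phi> (x k j) (h j))))"
      by (rule sum.swap)
    also have "\<dots> = ?R"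
      by (simp only: d_def of_real_sum of_real_diff norm_sum_op_sq sum_subtractf)
    finally show ?thesis .
  qed
  then have "completely_semi_map ip \<theta> \<Phi> \<longleftrightarrow> (\<forall>n x h. 0 \<le> (\<Sum>k<n. d n (x k) h))"
    by (simp add: completely_semi_map_def op_mat_le_def op_mat_positive_def less_eq_complex_def)
  also have "\<dots> \<longleftrightarrow> (\<forall>n x h. 0 \<le> d n x h)"
  proof (intro iffI allI)
    fix n x h
    assume *: "\<forall>n x h. 0 \<le> (\<Sum>k<n. d n (x k) h)"
    have "0 \<le> real n * d n x h" using *[rule_format, of n "\<lambda>_. x" h] by simp
    \<comment> \<open>For \<open>n = 0\<close> both sums are empty and the defect is
      \<open>0\<close>; otherwise the factor \<open>n\<close> cancels.\<close>
    then show "0 \<le> d n x h"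
      by (cases "n = 0") (simp_all add: d_def zero_le_mult_iff)
  next
    fix n x h
    assume "\<forall>n x h. 0 \<le> d n x h"
    then show "0 \<le> (\<Sum>k<n. d n (x k) h)" by (simp add: sum_nonneg)
  qed
  also have "\<dots> \<longleftrightarrow> (\<forall>n x h. norm (\<Sum>j<n. \<Phi> (x j) (h j)) \<le> norm (\<Sum>j<n::nat. \<Phi>\<^sub>0 (x j) (h j)))"
    by (simp add: d_def power2_le_iff_abs_le)
  finally show ?thesis .
qed

theorem theorem2p3:
  fixes act :: "'e::cbanach \<Rightarrow> 'a::unital_cstar_algebra \<Rightarrow> 'e"
    and ip :: "'e \<Rightarrow> 'e \<Rightarrow> 'a"
    and \<phi> :: "'a \<Rightarrow> 'h::chilbert_space \<Rightarrow>\<^sub>B 'h"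
    and \<pi> :: "'a \<Rightarrow> 'k::chilbert_space \<Rightarrow>\<^sub>B 'k"
    and V :: "'h \<Rightarrow>\<^sub>B 'k"
    and W\<^sub>\<phi> :: "'h\<^sub>\<phi>::chilbert_space \<Rightarrow>\<^sub>B 'k\<^sub>\<pi>::chilbert_space"
    and \<Phi>\<^sub>\<phi> :: "'e \<Rightarrow> 'h \<Rightarrow>\<^sub>B 'h\<^sub>\<phi>"
    and \<Psi>\<^sub>\<pi> :: "'e \<Rightarrow> 'k \<Rightarrow>\<^sub>B 'k\<^sub>\<pi>"
  assumes "hilbert_cstar_module act ip"
    and "completely_positive \<phi>"
    and "minimal_stinespring \<phi> \<pi> V"
    and "unitary_op W\<^sub>\<phi>"
    and "theta_map ip \<phi> \<Phi>\<^sub>\<phi>" and "nondegenerate \<Phi>\<^sub>\<phi>"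
    and "theta_representation ip \<pi> \<Psi>\<^sub>\<pi>" and "nondegenerate \<Psi>\<^sub>\<pi>"
    and "\<And>x. \<Phi>\<^sub>\<phi> x = adj W\<^sub>\<phi> o\<^sub>B \<Psi>\<^sub>\<pi> x o\<^sub>B V"
  shows
    "(\<forall>\<Phi> :: 'e \<Rightarrow> 'h \<Rightarrow>\<^sub>B 'h'::chilbert_space.
        (theta_map ip \<phi> \<Phi> \<longleftrightarrow>
           (\<exists>(S :: 'h\<^sub>\<phi> \<Rightarrow>\<^sub>B 'h') (W :: 'h' \<Rightarrow>\<^sub>B 'k\<^sub>\<pi>). isometry_op S \<and> coisometry_op W \<and>
              (\<forall>x. S o\<^sub>B \<Phi>\<^sub>\<phi> x = \<Phi> x \<and> \<Phi> x = adj W o\<^sub>B \<Psi>\<^sub>\<pi> x o\<^sub>B V))) \<and>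
        (theta_map ip \<phi> \<Phi> \<and> nondegenerate \<Phi> \<longleftrightarrow>
           (\<exists>(S :: 'h\<^sub>\<phi> \<Rightarrow>\<^sub>B 'h') (W :: 'h' \<Rightarrow>\<^sub>B 'k\<^sub>\<pi>). unitary_op S \<and> unitary_op W \<and>
              (\<forall>x. S o\<^sub>B \<Phi>\<^sub>\<phi> x = \<Phi> x \<and> \<Phi> x = adj W o\<^sub>B \<Psi>\<^sub>\<pi> x o\<^sub>B V)))) \<and>
     (\<forall>\<Phi> :: 'e \<Rightarrow> 'h \<Rightarrow>\<^sub>B 'h'.
        (completely_semi_map ip \<phi> \<Phi> \<longleftrightarrow>
           (\<exists>(S :: 'h\<^sub>\<phi> \<Rightarrow>\<^sub>B 'h') (W :: 'h' \<Rightarrow>\<^sub>B 'k\<^sub>\<pi>). contraction_op S \<and> contraction_op W \<and>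
              (\<forall>x. S o\<^sub>B \<Phi>\<^sub>\<phi> x = \<Phi> x \<and> \<Phi> x = adj W o\<^sub>B \<Psi>\<^sub>\<pi> x o\<^sub>B V))) \<and>
        (completely_semi_map ip \<phi> \<Phi> \<and> nondegenerate \<Phi> \<longleftrightarrow>
           (\<exists>(S :: 'h\<^sub>\<phi> \<Rightarrow>\<^sub>B 'h') (W :: 'h' \<Rightarrow>\<^sub>B 'k\<^sub>\<pi>).
              contraction_op S \<and> dense_range S \<and> contraction_op W \<and> inj (op_apply W) \<and>
              (\<forall>x. S o\<^sub>B \<Phi>\<^sub>\<phi> x = \<Phi> x \<and> \<Phi> x = adj W o\<^sub>B \<Psi>\<^sub>\<pi> x o\<^sub>B V)))) \<and>
     (\<forall>\<Psi> :: 'e \<Rightarrow> 'k \<Rightarrow>\<^sub>B 'k'::chilbert_space.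
        (theta_representation ip \<pi> \<Psi> \<longleftrightarrow>
           (\<exists>S :: 'k\<^sub>\<pi> \<Rightarrow>\<^sub>B 'k'. isometry_op S \<and> (\<forall>x. \<Psi> x = S o\<^sub>B \<Psi>\<^sub>\<pi> x))) \<and>
        (theta_representation ip \<pi> \<Psi> \<and> nondegenerate \<Psi> \<longleftrightarrow>
           (\<exists>S :: 'k\<^sub>\<pi> \<Rightarrow>\<^sub>B 'k'. unitary_op S \<and> (\<forall>x. \<Psi> x = S o\<^sub>B \<Psi>\<^sub>\<pi> x)))) \<and>
     (\<forall>(\<Psi> :: 'e \<Rightarrow> 'k \<Rightarrow>\<^sub>B 'k') (\<Phi> :: 'e \<Rightarrow> 'h \<Rightarrow>\<^sub>B 'h').
        theta_representation ip \<pi> \<Psi> \<and> theta_map ip \<phi> \<Phi> \<longrightarrow>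
        (\<exists>W :: 'h' \<Rightarrow>\<^sub>B 'k'. partial_isometry_op W \<and>
           (\<forall>x. \<Phi> x = adj W o\<^sub>B \<Psi> x o\<^sub>B V) \<and>
           (nondegenerate \<Phi> \<and> nondegenerate \<Psi> \<longrightarrow> unitary_op W)))"
proof -
  note cp = assms(2) and W\<^sub>\<phi> = assms(4) and \<Phi>\<^sub>\<phi> = assms(5,6)
  have lin: "clinear \<phi>" using cp by (simp add: completely_positive_def)
  have \<pi>: "star_representation \<pi>" and \<Psi>\<^sub>\<pi>: "theta_map ip \<pi> \<Psi>\<^sub>\<pi>" "nondegenerate \<Psi>\<^sub>\<pi>"
    using assms(7,8) by (simp_all add: theta_representation_def)
  have W\<^sub>\<phi>_iso: "isometry_op W\<^sub>\<phi>" and W\<^sub>\<phi>_adj: "isometry_op (adj W\<^sub>\<phi>)"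
    using W\<^sub>\<phi> by (simp_all add: unitary_op_iff coisometry_op_def)
  \<comment> \<open>Substituting the factorisation of \<open>\<Phi>\<^sub>\<phi>\<close> gives
    \<open>\<Phi> x = S o\<^sub>B adj W\<^sub>\<phi> o\<^sub>B \<Psi>\<^sub>\<pi> x o\<^sub>B
    V\<close>. The second identity thus follows from the first, and parts (i) and (ii) reduce to
    finding \<open>S\<close>.\<close>
  have through_W: "\<Phi> x = adj (W\<^sub>\<phi> o\<^sub>B adj S) o\<^sub>B \<Psi>\<^sub>\<pi> x o\<^sub>B V" if "\<And>x. S o\<^sub>B \<Phi>\<^sub>\<phi> x = \<Phi> x"
    for S :: "'h\<^sub>\<phi> \<Rightarrow>\<^sub>B 'h'" and \<Phi> :: "'e \<Rightarrow> 'h \<Rightarrow>\<^sub>B 'h'" and x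
    by (simp add: adj_comp op_eq_iff assms(9) flip: that)
  have coiso: "coisometry_op (W\<^sub>\<phi> o\<^sub>B adj S)" if "isometry_op S" for S :: "'h\<^sub>\<phi> \<Rightarrow>\<^sub>B 'h'"
    using that W\<^sub>\<phi>_adj by (simp add: coisometry_op_def adj_comp isometry_op_comp)

  \<comment> \<open>Part (i): \<open>\<phi>\<close>-maps as isometric images of
    \<open>\<Phi>\<^sub>\<phi>\<close>\<close>
  have i: "theta_map ip \<phi> \<Phi> \<longleftrightarrow>
      (\<exists>(S :: 'h\<^sub>\<phi> \<Rightarrow>\<^sub>B 'h') (W :: 'h' \<Rightarrow>\<^sub>B 'k\<^sub>\<pi>). isometry_op S \<and> coisometry_op W \<and>
        (\<forall>x. S o\<^sub>B \<Phi>\<^sub>\<phi> x = \<Phi> x \<and> \<Phi> x = adj W o\<^sub>B \<Psi>\<^sub>\<pi> x o\<^sub>B V))"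
    for \<Phi> :: "'e \<Rightarrow> 'h \<Rightarrow>\<^sub>B 'h'"
    using theta_maps_isometry[OF \<Phi>\<^sub>\<phi>, of \<Phi>] theta_map_isometry_comp[OF \<Phi>\<^sub>\<phi>(1), of _ \<Phi>]
      through_W coiso by blast
  have i': "theta_map ip \<phi> \<Phi> \<and> nondegenerate \<Phi> \<longleftrightarrow>
      (\<exists>(S :: 'h\<^sub>\<phi> \<Rightarrow>\<^sub>B 'h') (W :: 'h' \<Rightarrow>\<^sub>B 'k\<^sub>\<pi>). unitary_op S \<and> unitary_op W \<and>
        (\<forall>x. S o\<^sub>B \<Phi>\<^sub>\<phi> x = \<Phi> x \<and> \<Phi> x = adj W o\<^sub>B \<Psi>\<^sub>\<pi> x o\<^sub>B V))" (is "_ \<longleftrightarrow> ?R")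
    for \<Phi> :: "'e \<Rightarrow> 'h \<Rightarrow>\<^sub>B 'h'"
  proof
    assume \<Phi>: "theta_map ip \<phi> \<Phi> \<and> nondegenerate \<Phi>"
    then obtain S where S: "isometry_op S" "\<And>x. S o\<^sub>B \<Phi>\<^sub>\<phi> x = \<Phi> x"
      using theta_maps_isometry[OF \<Phi>\<^sub>\<phi>, of \<Phi>] by blast
    then have "unitary_op S"
      using \<Phi> nondegenerate_imp_dense_range isometry_dense_range_unitary by blast
    moreover from this have "unitary_op (W\<^sub>\<phi> o\<^sub>B adj S)"
      using W\<^sub>\<phi> by (intro unitary_op_comp unitary_op_adj)
    ultimately show ?R using S(2) through_W by blast
  next
    assume ?R
    then obtain S :: "'h\<^sub>\<phi> \<Rightarrow>\<^sub>B 'h'" where S: "unitary_op S" "\<And>x. S o\<^sub>B \<Phi>\<^sub>\<phi> x = \<Phi> x"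
      by blast
    then show "theta_map ip \<phi> \<Phi> \<and> nondegenerate \<Phi>"
      using theta_map_isometry_comp[OF \<Phi>\<^sub>\<phi>(1) _ S(2)] unitary_imp_dense_range[OF S(1)]
        dense_range_imp_nondegenerate[OF \<Phi>\<^sub>\<phi>(2) _ S(2)] by (simp add: unitary_op_iff)
  qed

  \<comment> \<open>Part (ii): completely semi-\<open>\<phi>\<close>-maps as contractive images of
    \<open>\<Phi>\<^sub>\<phi>\<close>\<close>
  have contr: "contraction_op (W\<^sub>\<phi> o\<^sub>B adj S)" if "contraction_op S" for S :: "'h\<^sub>\<phi> \<Rightarrow>\<^sub>B 'h'"
    using contraction_op_adj[OF that] W\<^sub>\<phi>_iso by (simp add: contraction_op_def isometry_op_def)
  note semi_iff = completely_semi_map_iff[OF lin \<Phi>\<^sub>\<phi>(1)]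
  have semi: "completely_semi_map ip \<phi> \<Phi> \<longleftrightarrow> (\<exists>S. contraction_op S \<and> (\<forall>x. S o\<^sub>B \<Phi>\<^sub>\<phi> x = \<Phi> x))"
    for \<Phi> :: "'e \<Rightarrow> 'h \<Rightarrow>\<^sub>B 'h'"
  proof
    assume "completely_semi_map ip \<phi> \<Phi>"
    then show "\<exists>S. contraction_op S \<and> (\<forall>x. S o\<^sub>B \<Phi>\<^sub>\<phi> x = \<Phi> x)"
      by (intro extend_nondegenerate[OF \<Phi>\<^sub>\<phi>(2)]) (simp add: semi_iff)
  next
    assume "\<exists>S. contraction_op S \<and> (\<forall>x. S o\<^sub>B \<Phi>\<^sub>\<phi> x = \<Phi> x)"
    then obtain S where S: "contraction_op S" "\<And>x. S o\<^sub>B \<Phi>\<^sub>\<phi> x = \<Phi> x" by blast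
    have "(\<Sum>j<n. \<Phi> (x j) (h j)) = S (\<Sum>j<n. \<Phi>\<^sub>\<phi> (x j) (h j))" for n :: nat and x h
      by (simp add: op_sum flip: S(2))
    then show "completely_semi_map ip \<phi> \<Phi>"
      using S(1) by (simp add: semi_iff contraction_op_def)
  qed
  have ii: "completely_semi_map ip \<phi> \<Phi> \<longleftrightarrow>
      (\<exists>(S :: 'h\<^sub>\<phi> \<Rightarrow>\<^sub>B 'h') (W :: 'h' \<Rightarrow>\<^sub>B 'k\<^sub>\<pi>). contraction_op S \<and> contraction_op W \<and>
        (\<forall>x. S o\<^sub>B \<Phi>\<^sub>\<phi> x = \<Phi> x \<and> \<Phi> x = adj W o\<^sub>B \<Psi>\<^sub>\<pi> x o\<^sub>B V))"
    for \<Phi> :: "'e \<Rightarrow> 'h \<Rightarrow>\<^sub>B 'h'"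
    unfolding semi using through_W contr by blast
  have ii': "completely_semi_map ip \<phi> \<Phi> \<and> nondegenerate \<Phi> \<longleftrightarrow>
      (\<exists>(S :: 'h\<^sub>\<phi> \<Rightarrow>\<^sub>B 'h') (W :: 'h' \<Rightarrow>\<^sub>B 'k\<^sub>\<pi>).
        contraction_op S \<and> dense_range S \<and> contraction_op W \<and> inj (op_apply W) \<and>
        (\<forall>x. S o\<^sub>B \<Phi>\<^sub>\<phi> x = \<Phi> x \<and> \<Phi> x = adj W o\<^sub>B \<Psi>\<^sub>\<pi> x o\<^sub>B V))" (is "_ \<longleftrightarrow> ?R")
    for \<Phi> :: "'e \<Rightarrow> 'h \<Rightarrow>\<^sub>B 'h'"
  proof
    assume \<Phi>: "completely_semi_map ip \<phi> \<Phi> \<and> nondegenerate \<Phi>"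
    then obtain S where S: "contraction_op S" "\<And>x. S o\<^sub>B \<Phi>\<^sub>\<phi> x = \<Phi> x"
      using semi by blast
    then have dense: "dense_range S"
      using \<Phi> nondegenerate_imp_dense_range by blast
    have "inj (op_apply W\<^sub>\<phi>)"
      using W\<^sub>\<phi>_iso by (metis injI isometry_op_iff)
    \<comment> \<open>Density of the range of \<open>S\<close> dualises to injectivity of
      \<open>adj S\<close>, which the injective \<open>W\<^sub>\<phi>\<close> preserves.\<close>
    then have "inj (op_apply (W\<^sub>\<phi> o\<^sub>B adj S))"
      using dense_range_imp_inj_adj[OF dense] by (simp add: inj_def)
    then show ?R using S dense contr through_W by blast
  next
    assume ?R
    then obtain S :: "'h\<^sub>\<phi> \<Rightarrow>\<^sub>B 'h'"
      where S: "contraction_op S" "dense_range S" "\<And>x. S o\<^sub>B \<Phi>\<^sub>\<phi> x = \<Phi> x" by blast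
    then show "completely_semi_map ip \<phi> \<Phi> \<and> nondegenerate \<Phi>"
      using semi dense_range_imp_nondegenerate[OF \<Phi>\<^sub>\<phi>(2) S(2,3)] by blast
  qed

  \<comment> \<open>Part (iii): the comparison of part (i), with \<open>\<pi>\<close> and
    \<open>\<Psi>\<^sub>\<pi>\<close> in place of \<open>\<phi>\<close> and
    \<open>\<Phi>\<^sub>\<phi>\<close>\<close>
  have rep_iff: "theta_representation ip \<pi> \<Psi> \<longleftrightarrow> theta_map ip \<pi> \<Psi>" for \<Psi> :: "'e \<Rightarrow> 'k \<Rightarrow>\<^sub>B 'k'"
    using \<pi> by (simp add: theta_representation_def)
  have iii: "theta_representation ip \<pi> \<Psi> \<longleftrightarrow>
      (\<exists>S :: 'k\<^sub>\<pi> \<Rightarrow>\<^sub>B 'k'. isometry_op S \<and> (\<forall>x. \<Psi> x = S o\<^sub>B \<Psi>\<^sub>\<pi> x))"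
    for \<Psi> :: "'e \<Rightarrow> 'k \<Rightarrow>\<^sub>B 'k'"
    unfolding rep_iff
    using theta_maps_isometry[OF \<Psi>\<^sub>\<pi>, of \<Psi>] theta_map_isometry_comp[OF \<Psi>\<^sub>\<pi>(1), of _ \<Psi>] by metis
  have iii': "theta_representation ip \<pi> \<Psi> \<and> nondegenerate \<Psi> \<longleftrightarrow>
      (\<exists>S :: 'k\<^sub>\<pi> \<Rightarrow>\<^sub>B 'k'. unitary_op S \<and> (\<forall>x. \<Psi> x = S o\<^sub>B \<Psi>\<^sub>\<pi> x))" (is "_ \<longleftrightarrow> ?R")
    for \<Psi> :: "'e \<Rightarrow> 'k \<Rightarrow>\<^sub>B 'k'"
  proof
    assume \<Psi>: "theta_representation ip \<pi> \<Psi> \<and> nondegenerate \<Psi>"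
    then obtain S :: "'k\<^sub>\<pi> \<Rightarrow>\<^sub>B 'k'" where S: "isometry_op S" "\<And>x. \<Psi> x = S o\<^sub>B \<Psi>\<^sub>\<pi> x"
      using iii by blast
    moreover have "dense_range S"
      using \<Psi> by (intro nondegenerate_imp_dense_range[of \<Psi> S \<Psi>\<^sub>\<pi>]) (simp_all add: S(2))
    ultimately show ?R using isometry_dense_range_unitary by blast
  next
    assume ?R
    then obtain S :: "'k\<^sub>\<pi> \<Rightarrow>\<^sub>B 'k'" where S: "unitary_op S" "\<And>x. \<Psi> x = S o\<^sub>B \<Psi>\<^sub>\<pi> x" by blast
    then show "theta_representation ip \<pi> \<Psi> \<and> nondegenerate \<Psi>"
      using iii unitary_imp_dense_range[OF S(1)]
        dense_range_imp_nondegenerate[OF \<Psi>\<^sub>\<pi>(2) _ S(2)[symmetric]] unitary_op_iff by blast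
  qed

  \<comment> \<open>Part (iv): a \<open>\<pi>\<close>-representation and a \<open>\<phi>\<close>-map
    linked by a partial isometry\<close>
  have iv: "\<exists>W :: 'h' \<Rightarrow>\<^sub>B 'k'. partial_isometry_op W \<and>
      (\<forall>x. \<Phi> x = adj W o\<^sub>B \<Psi> x o\<^sub>B V) \<and> (nondegenerate \<Phi> \<and> nondegenerate \<Psi> \<longrightarrow> unitary_op W)"
    if rep: "theta_representation ip \<pi> \<Psi> \<and> theta_map ip \<phi> \<Phi>"
    for \<Psi> :: "'e \<Rightarrow> 'k \<Rightarrow>\<^sub>B 'k'" and \<Phi> :: "'e \<Rightarrow> 'h \<Rightarrow>\<^sub>B 'h'"
  proof -
    obtain S where S: "isometry_op S" "\<And>x. S o\<^sub>B \<Phi>\<^sub>\<phi> x = \<Phi> x"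
      using theta_maps_isometry[OF \<Phi>\<^sub>\<phi>, of \<Phi>] rep by blast
    obtain R where R: "isometry_op R" "\<And>x. R o\<^sub>B \<Psi>\<^sub>\<pi> x = \<Psi> x"
      using theta_maps_isometry[OF \<Psi>\<^sub>\<pi>, of \<Psi>] rep rep_iff by blast
    define W where "W = R o\<^sub>B (W\<^sub>\<phi> o\<^sub>B adj S)"
    have "partial_isometry_op W"
      unfolding W_def by (intro partial_isometry_op_comp coiso S R)
    \<comment> \<open>In \<open>adj W o\<^sub>B \<Psi> x\<close> the factor
      \<open>adj R o\<^sub>B R\<close> cancels, which leaves the identity of
      \<open>through_W\<close>.\<close>
    moreover have "\<Phi> x = adj W o\<^sub>B \<Psi> x o\<^sub>B V" for x
      using through_W[OF S(2), of x] R(1)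
      by (simp add: W_def adj_comp op_eq_iff isometry_op_iff flip: R(2))
    moreover have "unitary_op W" if "nondegenerate \<Phi> \<and> nondegenerate \<Psi>"
    proof -
      have "unitary_op S" "unitary_op R"
        using that S R nondegenerate_imp_dense_range isometry_dense_range_unitary by blast+
      then show ?thesis
        unfolding W_def using W\<^sub>\<phi> by (intro unitary_op_comp unitary_op_adj)
    qed
    ultimately show ?thesis by blast
  qed
  show ?thesis
    using i i' ii ii' iii iii' iv by (intro conjI allI impI)
qed

end
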